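(* There is no $2$-geodetic digraph with minimum out-degree at least $2$ and order $9$ whose in-degree sequence is $(1,2,\dots,2,3)$, i.e. exactly one vertex has in-degree $1$, exactly one has in-degree $3$, and all others have in-degree $2$.
   Context: A digraph is $2$-geodetic if for any two vertices $u,v$ there is at most one directed walk from $u$ to $v$ of length at most $2$. Note $9 = M(2,2)+2$ with $M(2,2)=1+2+4$. The in-degree sequence is the list of in-degrees in non-decreasing order. *)

theory Defs
  imports "Graph_Theory.Digraph" "Graph_Theory.Arc_Walk" "HOL-Library.Multiset"
begin

text \<open>
  Walks of length 0 are included, so a \<open>k\<close>-geodetic digraph with \<open>k \<ge> 2\<close> has neither loops nor
  directed 2-cycles.
\<close>

definition k_geodetic :: "nat \<Rightarrow> ('a, 'b) pre_digraph \<Rightarrow> bool" where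
  "k_geodetic k G \<longleftrightarrow>
    (\<forall>u \<in> verts G. \<forall>v \<in> verts G. \<exists>\<^sub>\<le>\<^sub>1 p. pre_digraph.awalk G u p v \<and> length p \<le> k)"

text \<open>Meaningful only for a finite nonempty vertex set.\<close>

definition min_out_degree :: "('a, 'b) pre_digraph \<Rightarrow> nat" where
  "min_out_degree G = Min (out_degree G ` verts G)"

definition in_degree_sequence :: "('a, 'b) pre_digraph \<Rightarrow> nat list" where
  "in_degree_sequence G = sorted_list_of_multiset (image_mset (in_degree G) (mset_set (verts G)))"

end

theory Submission
  imports Defs
begin

text \<open>
  Counting arcs shows that all out-degrees are 2. Let \<open>x\<close> have in-degree 3 and \<open>z\<close> in-degree 1. The
  vertices at distance at most 2 to \<open>x\<close> number \<open>4\<close> plus the in-degrees of the in-neighbours of \<open>x\<close>.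
  As there are only 9 vertices, \<open>z\<close> is an in-neighbour of \<open>x\<close> and these vertices are all of them:
  \<open>x\<close>, its in-neighbours \<open>z, a, b\<close>, and their in-neighbours \<open>w\<close>, \<open>a1, a2\<close> and \<open>b1, b2\<close>. Each
  vertex other than \<open>x\<close> has one further out-neighbour, which lies in \<open>{w, a1, a2, b1, b2}\<close>, and so
  do both out-neighbours of \<open>x\<close>. Up to symmetry the latter are \<open>{w, a1}\<close> or \<open>{a1, b1}\<close>, and either
  choice forces the other arcs until 2-geodecity or an in-degree is violated.
\<close>

section \<open>2-geodetic relations\<close>

text \<open>The axioms exclude, in this order, pairs of walks with common ends of lengths 0 and 1, 0
  and 2, 1 and 2, 2 and 2; parallel arcs cannot occur in a relation.\<close>

locale geodetic2 =
  fixes E :: "'a \<Rightarrow> 'a \<Rightarrow> bool"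
  assumes loopfree: "\<not> E u u"
    and no_2cycle: "E u v \<Longrightarrow> \<not> E v u"
    and no_shortcut: "E u v \<Longrightarrow> E v w \<Longrightarrow> \<not> E u w"
    and no_diamond: "E u v \<Longrightarrow> E v w \<Longrightarrow> E u v' \<Longrightarrow> E v' w \<Longrightarrow> v = v'"
begin

definition in_ball :: "'a \<Rightarrow> 'a set" where
  "in_ball v = insert v ({u. E u v} \<union> (\<Union>u\<in>{u. E u v}. {t. E t u}))"

text \<open>A vertex counted twice would have two walks of length at most 2 to \<open>v\<close>, so
  the layers are disjoint, and so are the in-neighbourhoods of the in-neighbours of
  \<open>v\<close>.\<close>

lemma card_in_ball:
  assumes "\<And>v. finite {u. E u v}"
  shows "card (in_ball v) = 1 + card {u. E u v} + (\<Sum>u | E u v. card {t. E t u})"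
proof -
  have "card (\<Union>u\<in>{u. E u v}. {t. E t u}) = (\<Sum>u | E u v. card {t. E t u})"
    by (intro card_UN_disjoint) (use assms no_diamond in blast)+
  moreover have "{u. E u v} \<inter> (\<Union>u\<in>{u. E u v}. {t. E t u}) = {}"
    using no_shortcut by blast
  moreover have "v \<notin> {u. E u v} \<union> (\<Union>u\<in>{u. E u v}. {t. E t u})"
    using loopfree no_2cycle by blast
  ultimately show ?thesis
    unfolding in_ball_def using assms by (simp add: card_Un_disjoint)
qed

end

text \<open>
  The arc leaving \<open>u \<noteq> x\<close> that does not belong to the in-tree of \<open>x\<close> has head \<open>fu\<close>.
\<close>

locale in_tree_config = geodetic2 +
  fixes x z a b w a1 a2 b1 b2 p q fz fa fb fw fa1 fa2 fb1 fb2 :: 'a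
  assumes dist: "distinct [x, z, a, b, w, a1, a2, b1, b2]"
    and succ: "\<And>u. E x u \<longleftrightarrow> u = p \<or> u = q"
      "\<And>u. E z u \<longleftrightarrow> u = x \<or> u = fz"
      "\<And>u. E a u \<longleftrightarrow> u = x \<or> u = fa"
      "\<And>u. E b u \<longleftrightarrow> u = x \<or> u = fb"
      "\<And>u. E w u \<longleftrightarrow> u = z \<or> u = fw"
      "\<And>u. E a1 u \<longleftrightarrow> u = a \<or> u = fa1"
      "\<And>u. E a2 u \<longleftrightarrow> u = a \<or> u = fa2"
      "\<And>u. E b1 u \<longleftrightarrow> u = b \<or> u = fb1"
      "\<And>u. E b2 u \<longleftrightarrow> u = b \<or> u = fb2"
    and pq: "p \<noteq> q"
    and range: "p \<in> {w, a1, a2, b1, b2}"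
      "q \<in> {w, a1, a2, b1, b2}"
      "fz \<in> {w, a1, a2, b1, b2}"
      "fa \<in> {w, a1, a2, b1, b2}"
      "fb \<in> {w, a1, a2, b1, b2}"
      "fw \<in> {w, a1, a2, b1, b2}"
      "fa1 \<in> {w, a1, a2, b1, b2}"
      "fa2 \<in> {w, a1, a2, b1, b2}"
      "fb1 \<in> {w, a1, a2, b1, b2}"
      "fb2 \<in> {w, a1, a2, b1, b2}"
    and indeg: "y \<noteq> x \<Longrightarrow> E u y \<Longrightarrow> E v y \<Longrightarrow> E t y \<Longrightarrow> u = v \<or> v = t \<or> u = t"
begin

section \<open>Symmetries of the configuration\<close>

text \<open>This swap and the three after it carry every later lemma over to its mirror images, so
  that each case is treated only once.\<close>

lemma swap_ab: "in_tree_config E x z b a w b1 b2 a1 a2 p q fz fb fa fw fb1 fb2 fa1 fa2"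
proof -
  have eq: "{w, a1, a2, b1, b2} = {w, b1, b2, a1, a2}"
    by (simp add: insert_commute)
  have distinct: "distinct [x, z, b, a, w, b1, b2, a1, a2]"
    using dist by (simp add: eq_commute)
  show ?thesis
    by (intro in_tree_config.intro in_tree_config_axioms.intro geodetic2_axioms)
      (fact distinct succ pq indeg range[unfolded eq])+
qed

lemma swap_a: "in_tree_config E x z a b w a2 a1 b1 b2 p q fz fa fb fw fa2 fa1 fb1 fb2"
proof -
  have eq: "{w, a1, a2, b1, b2} = {w, a2, a1, b1, b2}"
    by (simp add: insert_commute)
  have distinct: "distinct [x, z, a, b, w, a2, a1, b1, b2]"
    using dist by (simp add: eq_commute)
  show ?thesis
    by (intro in_tree_config.intro in_tree_config_axioms.intro geodetic2_axioms)
      (fact distinct succ pq indeg range[unfolded eq])+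
qed

lemma swap_b: "in_tree_config E x z a b w a1 a2 b2 b1 p q fz fa fb fw fa1 fa2 fb2 fb1"
proof -
  have eq: "{w, a1, a2, b1, b2} = {w, a1, a2, b2, b1}"
    by (simp add: insert_commute)
  have distinct: "distinct [x, z, a, b, w, a1, a2, b2, b1]"
    using dist by (simp add: eq_commute)
  show ?thesis
    by (intro in_tree_config.intro in_tree_config_axioms.intro geodetic2_axioms)
      (fact distinct succ pq indeg range[unfolded eq])+
qed

lemma swap_pq: "in_tree_config E x z a b w a1 a2 b1 b2 q p fz fa fb fw fa1 fa2 fb1 fb2"
  by (intro in_tree_config.intro in_tree_config_axioms.intro geodetic2_axioms)
    (fact succ indeg pq[symmetric] dist range | (subst disj_commute, fact succ))+

section \<open>Constraints on the free arcs\<close>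

lemma fa_cases: "fa = w \<or> fa = b1 \<or> fa = b2"
  using range(4) no_2cycle[of a fa] succ by auto

text \<open>Each of \<open>z\<close>, \<open>a\<close>, \<open>b\<close> has an arc to
  \<open>x\<close>, so sharing an out-neighbour with \<open>x\<close> would create a
  shortcut.\<close>

lemma fz_fa_fb_notin: "p \<notin> {fz, fa, fb}" "q \<notin> {fz, fa, fb}"
  using no_shortcut[of z x] no_shortcut[of a x] no_shortcut[of b x] succ by auto

text \<open>\<open>fa1 = a2\<close> would give the walk \<open>a1\<close>, \<open>a2\<close>,
  \<open>a\<close> beside the arc from \<open>a1\<close> to \<open>a\<close>.\<close>

lemma fa1_cases: "fa1 = w \<or> fa1 = b1 \<or> fa1 = b2"
  using range(7) loopfree[of a1] no_shortcut[of a1 fa1 a] succ by auto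

lemma fa1_neq_fa: "fa1 \<noteq> fa"
  using no_shortcut[of a1 a fa] succ by auto

lemma fw_neq_fz: "fw \<noteq> fz" "fw \<noteq> w" "fz \<noteq> w"
  using no_shortcut[of w z fz] loopfree[of w] no_2cycle[of z w] succ by auto

lemma fb_cases: "fb = w \<or> fb = a1 \<or> fb = a2"
  using in_tree_config.fa_cases[OF swap_ab] .

lemma fa2_cases: "fa2 = w \<or> fa2 = b1 \<or> fa2 = b2" and fa2_neq_fa: "fa2 \<noteq> fa"
  using in_tree_config.fa1_cases[OF swap_a] in_tree_config.fa1_neq_fa[OF swap_a] by auto

lemma fb1_cases: "fb1 = w \<or> fb1 = a1 \<or> fb1 = a2" and fb1_neq_fb: "fb1 \<noteq> fb"
  using in_tree_config.fa1_cases[OF swap_ab] in_tree_config.fa1_neq_fa[OF swap_ab] by auto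

lemma fb2_cases: "fb2 = w \<or> fb2 = a1 \<or> fb2 = a2" and fb2_neq_fb: "fb2 \<noteq> fb"
  using in_tree_config.fa2_cases[OF swap_ab] in_tree_config.fa2_neq_fa[OF swap_ab] by auto

section \<open>Case analysis on the out-neighbours of \<open>x\<close>\<close>

lemma case_w_a1_b1:
  assumes "p = w" "q = a1" "fa = b1"
  shows False
proof -
  have fb: "fb = a2"
    using fb_cases fz_fa_fb_notin assms by auto
  have fa1: "fa1 = b2"
    using fa1_cases fa1_neq_fa no_shortcut[of x q fa1] succ assms by auto
  have "fb2 = w"
    using fb2_cases fb2_neq_fb fb fa1 no_2cycle[of a1 b2] succ by auto
  moreover have "fb1 = w \<or> fb1 = a1"
    using fb1_cases fb1_neq_fb fb by auto
  \<comment> \<open>\<open>fb1 = w\<close> would give \<open>w\<close> the three in-neighbours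
    \<open>x\<close>, \<open>b1\<close>, \<open>b2\<close>.\<close>
  ultimately have "fb1 = a1"
    using indeg[of w x b1 b2] dist succ assms by auto
  moreover have "E a x" "E x a1" "E a b1" "x \<noteq> b1"
    using succ assms dist by auto
  \<comment> \<open>Two walks lead from \<open>a\<close> to \<open>a1\<close>, one via
    \<open>x\<close> and one via \<open>b1\<close>.\<close>
  ultimately show False
    using no_diamond[of a x a1 b1] succ by auto
qed

lemma not_w_a1: "\<not> (p = w \<and> q = a1)"
proof
  assume *: "p = w \<and> q = a1"
  then have "fa = b1 \<or> fa = b2"
    using fa_cases fz_fa_fb_notin by auto
  then show False
    using * case_w_a1_b1 in_tree_config.case_w_a1_b1[OF swap_b] by blast
qed

lemma case_a1_b1_w:
  assumes "p = a1" "q = b1" "fa = w"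
  shows False
proof -
  have fa1: "fa1 = b2"
    using fa1_cases fa1_neq_fa no_shortcut[of x p fa1] succ assms by auto
  have "fb1 \<noteq> a1" "fb = w \<or> fb = a2"
    using no_shortcut[of x q a1] fb_cases fz_fa_fb_notin succ assms by auto
  \<comment> \<open>Both \<open>fb\<close> and \<open>fb1\<close> lie in \<open>{w, a2}\<close> and
    they differ, so one of them is \<open>w\<close> and the other is \<open>a2\<close>.\<close>
  then have "fb = w \<or> fb1 = w"
    using fb1_cases fb1_neq_fb by auto
  then have "E b w \<or> E b1 w"
    using succ by auto
  then have w_full: "E u w \<Longrightarrow> u = a \<or> u = b \<or> u = b1" for u
    using indeg[of w u a b] indeg[of w u a b1] dist succ assms by auto
  \<comment> \<open>Walks from \<open>a\<close> via \<open>x\<close> already reach \<open>a1\<close>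
    and \<open>b1\<close>; the arc from \<open>a\<close> to \<open>w\<close> would start a second
    one.\<close>
  have "fw \<noteq> a1" "fw \<noteq> b1"
    using no_diamond[of a x a1 w] no_diamond[of a x b1 w] succ assms dist by auto
  then have fw: "fw = a2 \<or> fw = b2"
    using fw_neq_fz range(6) by auto
  have a2: "E b a2 \<or> E b1 a2"
    using \<open>fb = w \<or> fb = a2\<close> \<open>fb1 \<noteq> a1\<close> fb1_cases fb1_neq_fb succ by auto
  have "fz = a2 \<or> fz = b2"
    using fz_fa_fb_notin fw_neq_fz range(3) assms by auto
  \<comment> \<open>\<open>fz\<close> and \<open>fw\<close> are distinct elements of
    \<open>{a2, b2}\<close>, so one of them is \<open>a2\<close>.\<close>
  then have "E z a2 \<or> E w a2"
    using fw fw_neq_fz succ by auto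
  \<comment> \<open>The in-degree of \<open>a2\<close> is exhausted by one vertex of
    \<open>{b, b1}\<close> and one of \<open>{z, w}\<close>.\<close>
  then have "\<not> E b2 a2"
    using a2 indeg[of a2 b2 b z] indeg[of a2 b2 b1 z] indeg[of a2 b2 b w] indeg[of a2 b2 b1 w] dist
    by auto
  moreover have "\<not> E b2 w"
    using w_full[of b2] dist by auto
  ultimately have "fb2 = a1"
    using fb2_cases succ by auto
  then show False
    using no_2cycle[of a1 b2] fa1 succ by auto
qed

lemma not_a1_b1: "\<not> (p = a1 \<and> q = b1)"
proof
  assume *: "p = a1 \<and> q = b1"
  \<comment> \<open>\<open>fa\<close> and \<open>fa1\<close> are distinct and neither is
    \<open>b1\<close>, so they are \<open>w\<close> and \<open>b2\<close> in some order; likewise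
    \<open>fb\<close> and \<open>fb1\<close> are \<open>w\<close> and \<open>a2\<close>.\<close>
  have "fa1 = w \<or> fa = w"
    using * fa1_cases fa1_neq_fa fa_cases fz_fa_fb_notin no_shortcut[of x p fa1] succ by auto
  moreover have "fb1 = w \<or> fb = w"
    using * fb1_cases fb1_neq_fb fb_cases fz_fa_fb_notin no_shortcut[of x q fb1] succ by auto
  moreover have "\<not> (fa1 = w \<and> fb1 = w)"
    using * no_diamond[of x a1 w b1] dist succ by auto
  ultimately have "fa = w \<or> fb = w" by blast
  then show False
    \<comment> \<open>Exchanging the branches alone reverses the roles of \<open>p\<close> and
      \<open>q\<close>, hence the additional swap.\<close>
    using * case_a1_b1_w
      in_tree_config.case_a1_b1_w[OF in_tree_config.swap_ab[OF swap_pq]] by blast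
qed

lemma not_a_b: "\<not> (p \<in> {a1, a2} \<and> q \<in> {b1, b2})"
  using not_a1_b1 in_tree_config.not_a1_b1[OF swap_a] in_tree_config.not_a1_b1[OF swap_b]
    in_tree_config.not_a1_b1[OF in_tree_config.swap_a[OF swap_b]] by blast

lemma not_w_a: "\<not> (p = w \<and> q \<in> {a1, a2})"
  using not_w_a1 in_tree_config.not_w_a1[OF swap_a] by blast

text \<open>Both siblings have an arc to \<open>a\<close>, which would give two walks from
  \<open>x\<close> to \<open>a\<close>.\<close>

lemma not_a_a: "\<not> (p \<in> {a1, a2} \<and> q \<in> {a1, a2})"
  using no_diamond[of x p a q] pq succ by auto

lemma not_w: "p \<noteq> w"
  using not_w_a in_tree_config.not_w_a[OF swap_ab] pq range(2) by auto

lemma contradiction: False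
proof -
  have "q \<noteq> w" "\<not> (q \<in> {a1, a2} \<and> p \<in> {b1, b2})" "\<not> (p \<in> {b1, b2} \<and> q \<in> {b1, b2})"
    using in_tree_config.not_w[OF swap_pq] in_tree_config.not_a_b[OF swap_pq]
      in_tree_config.not_a_a[OF swap_ab] by auto
  then show False
    using not_w not_a_b not_a_a range(1,2) by auto
qed

end

section \<open>Extracting the configuration from the degrees\<close>

context geodetic2
begin

lemma degree_2_except_1_3_False:
  assumes "finite V" and card_V: "card V = 9"
    and E_V: "\<And>u v. E u v \<Longrightarrow> u \<in> V \<and> v \<in> V"
    and out: "\<And>u. u \<in> V \<Longrightarrow> card {v. E u v} = 2"
    and x: "x \<in> V" "card {u. E u x} = 3"
    and z: "z \<in> V" "card {u. E u z} = 1"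
    and indeg: "\<And>v. v \<in> V - {x, z} \<Longrightarrow> card {u. E u v} = 2"
  shows False
proof -
  define N where "N v = {u. E u v}" for v
  have fin: "finite (N v)" for v
    unfolding N_def by (rule finite_subset[OF _ \<open>finite V\<close>]) (use E_V in blast)
  have ball_V: "in_ball x \<subseteq> V"
    unfolding in_ball_def using E_V x by blast
  have card_ball: "card (in_ball x) = 4 + (\<Sum>u\<in>N x. card (N u))"
    using card_in_ball[of x] fin x unfolding N_def by simp
  have card_N: "card (N u) = 2" if "u \<in> N x - {z}" for u
    using indeg[of u] that loopfree E_V unfolding N_def by auto
  have zx: "z \<in> N x"
  proof (rule ccontr)
    \<comment> \<open>Then all three in-neighbours of \<open>x\<close> have in-degree 2, and the
      in-ball has 4 + 6 = 10 elements.\<close>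
    assume "z \<notin> N x"
    then have "(\<Sum>u\<in>N x. card (N u)) = (\<Sum>u\<in>N x. 2)"
      using card_N by (intro sum.cong) auto
    then have "card (in_ball x) = 10"
      using card_ball x by (simp add: N_def)
    then show False
      using card_mono[OF \<open>finite V\<close> ball_V] card_V by simp
  qed
  have "card (N x - {z}) = 2"
    using zx fin x by (simp add: N_def)
  then obtain a b where ab: "N x - {z} = {a, b}" "a \<noteq> b"
    by (auto simp: card_2_iff)
  then have Nx: "N x = {z, a, b}" "z \<noteq> a" "z \<noteq> b"
    using zx by auto
  obtain w where Nz: "N z = {w}"
    using z unfolding N_def by (auto simp: card_1_singleton_iff)
  obtain a1 a2 where Na: "N a = {a1, a2}" "a1 \<noteq> a2"
    using card_N[of a] ab by (auto simp: card_2_iff)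
  obtain b1 b2 where Nb: "N b = {b1, b2}" "b1 \<noteq> b2"
    using card_N[of b] ab by (auto simp: card_2_iff)
  \<comment> \<open>The in-ball has 4 + 1 + 2 + 2 = 9 elements.\<close>
  have "in_ball x = V"
    using card_ball Nx ab Nz Na Nb card_V \<open>finite V\<close> ball_V
    by (intro card_subset_eq) auto
  moreover have ball: "in_ball x = set [x, z, a, b, w, a1, a2, b1, b2]"
    using Nx Nz Na Nb unfolding in_ball_def N_def by auto
  ultimately have V: "V = {x, z, a, b, w, a1, a2, b1, b2}"
    by simp
  \<comment> \<open>A list of nine entries that covers nine vertices has no repetition.\<close>
  have dist: "distinct [x, z, a, b, w, a1, a2, b1, b2]"
    using card_V \<open>in_ball x = V\<close> ball by (intro card_distinct) simp
  have E_x: "E u x \<longleftrightarrow> u = z \<or> u = a \<or> u = b"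
    and E_z: "E u z \<longleftrightarrow> u = w"
    and E_a: "E u a \<longleftrightarrow> u = a1 \<or> u = a2"
    and E_b: "E u b \<longleftrightarrow> u = b1 \<or> u = b2" for u
    using Nx(1) Nz Na(1) Nb(1) unfolding N_def by blast+
  have other: "\<exists>t. t \<noteq> v \<and> (\<forall>y. E u y \<longleftrightarrow> y = v \<or> y = t)" if uv: "E u v" for u v
  proof -
    have "card {y. E u y} = 2"
      using out E_V uv by blast
    then obtain s t where "{y. E u y} = {s, t}" "s \<noteq> t"
      by (auto simp: card_2_iff)
    then show ?thesis
      using uv by (metis insert_iff mem_Collect_eq singletonD)
  qed
  have S: "v \<in> {w, a1, a2, b1, b2}" if "E u v" "v \<notin> {x, z, a, b}" for u v
    using E_V[OF \<open>E u v\<close>] that V by blast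
  obtain p q where p_q: "{y. E x y} = {p, q}" "p \<noteq> q"
    using out[OF x(1)] by (auto simp: card_2_iff)
  then have E_x_iff: "E x y \<longleftrightarrow> y = p \<or> y = q" for y
    by blast
  obtain fz where fz: "fz \<noteq> x" "\<And>y. E z y \<longleftrightarrow> y = x \<or> y = fz"
    using other[of z x] E_x by blast
  obtain fa where fa: "fa \<noteq> x" "\<And>y. E a y \<longleftrightarrow> y = x \<or> y = fa"
    using other[of a x] E_x by blast
  obtain fb where fb: "fb \<noteq> x" "\<And>y. E b y \<longleftrightarrow> y = x \<or> y = fb"
    using other[of b x] E_x by blast
  obtain fw where fw: "fw \<noteq> z" "\<And>y. E w y \<longleftrightarrow> y = z \<or> y = fw"
    using other[of w z] E_z by blast
  obtain fa1 where fa1: "fa1 \<noteq> a" "\<And>y. E a1 y \<longleftrightarrow> y = a \<or> y = fa1"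
    using other[of a1 a] E_a by blast
  obtain fa2 where fa2: "fa2 \<noteq> a" "\<And>y. E a2 y \<longleftrightarrow> y = a \<or> y = fa2"
    using other[of a2 a] E_a by blast
  obtain fb1 where fb1: "fb1 \<noteq> b" "\<And>y. E b1 y \<longleftrightarrow> y = b \<or> y = fb1"
    using other[of b1 b] E_b by blast
  obtain fb2 where fb2: "fb2 \<noteq> b" "\<And>y. E b2 y \<longleftrightarrow> y = b \<or> y = fb2"
    using other[of b2 b] E_b by blast
  note succ = fz(2) fa(2) fb(2) fw(2) fa1(2) fa2(2) fb1(2) fb2(2)
  \<comment> \<open>All arcs into \<open>x\<close>, \<open>z\<close>, \<open>a\<close>,
    \<open>b\<close> belong to the in-tree, and the side conditions exclude exactly these.\<close>
  have range: "v \<in> {w, a1, a2, b1, b2}" if "E u v"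
    "u \<in> {z, a, b} \<Longrightarrow> v \<noteq> x" "u = w \<Longrightarrow> v \<noteq> z"
    "u \<in> {a1, a2} \<Longrightarrow> v \<noteq> a" "u \<in> {b1, b2} \<Longrightarrow> v \<noteq> b" for u v
    using S[OF that(1)] that E_x E_z E_a E_b by blast
  have indeg_le: "u = v \<or> v = t \<or> u = t" if "y \<noteq> x" "E u y" "E v y" "E t y" for y u v t
  proof (rule ccontr)
    assume "\<not> ?thesis"
    then have "card {u, v, t} = 3"
      by auto
    moreover have "card {u, v, t} \<le> card (N y)"
      using that fin by (intro card_mono) (auto simp: N_def)
    moreover have "card (N y) \<le> 2"
      using that indeg[of y] z E_V by (cases "y = z") (auto simp: N_def)
    ultimately show False
      by simp
  qed
  have "in_tree_config E x z a b w a1 a2 b1 b2 p q fz fa fb fw fa1 fa2 fb1 fb2"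
  proof (intro in_tree_config.intro in_tree_config_axioms.intro geodetic2_axioms)
    show "p \<in> {w, a1, a2, b1, b2}" "q \<in> {w, a1, a2, b1, b2}"
      using range[of x] E_x_iff dist by auto
    show "fz \<in> {w, a1, a2, b1, b2}"
      by (rule range[of z]) (use fz dist in auto)
    show "fa \<in> {w, a1, a2, b1, b2}"
      by (rule range[of a]) (use fa dist in auto)
    show "fb \<in> {w, a1, a2, b1, b2}"
      by (rule range[of b]) (use fb dist in auto)
    show "fw \<in> {w, a1, a2, b1, b2}"
      by (rule range[of w]) (use fw dist in auto)
    show "fa1 \<in> {w, a1, a2, b1, b2}"
      by (rule range[of a1]) (use fa1 dist in auto)
    show "fa2 \<in> {w, a1, a2, b1, b2}"
      by (rule range[of a2]) (use fa2 dist in auto)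
    show "fb1 \<in> {w, a1, a2, b1, b2}"
      by (rule range[of b1]) (use fb1 dist in auto)
    show "fb2 \<in> {w, a1, a2, b1, b2}"
      by (rule range[of b2]) (use fb2 dist in auto)
  qed (fact dist E_x_iff succ p_q indeg_le)+
  then show False
    by (rule in_tree_config.contradiction)
qed

end

section \<open>From digraphs to relations\<close>

text \<open>Each violation yields two different arc lists of length at most 2 with common ends; for
  loops and 2-cycles one of them is the empty walk.\<close>

lemma (in digraph) geodetic2_dominates:
  assumes "k_geodetic 2 G"
  shows "geodetic2 (\<lambda>u v. u \<rightarrow> v)"
proof -
  have unique: "p = p'" if "awalk u p v" "awalk u p' v" "length p \<le> 2" "length p' \<le> 2" for u v p p'
    using assms that unfolding k_geodetic_def Uniq_def by (meson awalk_hd_in_verts awalk_last_in_verts)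
  have dom: "u \<rightarrow> v \<longleftrightarrow> (\<exists>e. awalk u [e] v)" for u v
    by (auto simp: awalk_simps arcs_ends_def arc_to_ends_def)
  have cons: "awalk u [e, e'] w" if "awalk u [e] v" "awalk v [e'] w" for u v w e e'
    using that by (auto simp: awalk_simps)
  have nil: "awalk u [] u" if "awalk u p v" for u p v
    using that by (auto simp: awalk_simps)
  show ?thesis
  proof
    show "\<not> u \<rightarrow> u" for u
    proof
      assume "u \<rightarrow> u"
      then obtain e where "awalk u [e] u"
        using dom by blast
      from unique[OF this nil[OF this]] show False
        by simp
    qed
    show "\<not> v \<rightarrow> u" if "u \<rightarrow> v" for u v
    proof
      assume "v \<rightarrow> u"
      then obtain e e' where "awalk u [e] v" "awalk v [e'] u"
        using \<open>u \<rightarrow> v\<close> dom by blast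
      from unique[OF cons[OF this] nil[OF this(1)]] show False
        by simp
    qed
    show "\<not> u \<rightarrow> w" if "u \<rightarrow> v" "v \<rightarrow> w" for u v w
    proof
      assume "u \<rightarrow> w"
      then obtain e e' f where "awalk u [e] v" "awalk v [e'] w" "awalk u [f] w"
        using \<open>u \<rightarrow> v\<close> \<open>v \<rightarrow> w\<close> dom by blast
      from unique[OF cons[OF this(1,2)] this(3)] show False
        by simp
    qed
    show "v = v'" if "u \<rightarrow> v" "v \<rightarrow> w" "u \<rightarrow> v'" "v' \<rightarrow> w" for u v v' w
    proof -
      obtain e f where e: "awalk u [e] v" "awalk v [f] w"
        using \<open>u \<rightarrow> v\<close> \<open>v \<rightarrow> w\<close> dom by blast
      obtain e' f' where e': "awalk u [e'] v'" "awalk v' [f'] w"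
        using \<open>u \<rightarrow> v'\<close> \<open>v' \<rightarrow> w\<close> dom by blast
      \<comment> \<open>Uniqueness of walks identifies arcs; equal first arcs then have equal
        heads.\<close>
      have "e = e'"
        using unique[OF cons[OF e] cons[OF e']] by simp
      then show ?thesis
        using e e' by (simp add: awalk_simps)
    qed
  qed
qed

lemma (in digraph) card_out_neighbours: "card {v. u \<rightarrow> v} = out_degree G u"
proof -
  have "{v. u \<rightarrow> v} = head G ` out_arcs G u"
    by (auto simp: arcs_ends_def arc_to_ends_def)
  moreover have "inj_on (head G) (out_arcs G u)"
    using no_multi_arcs by (auto simp: inj_on_def arc_to_ends_def)
  ultimately show ?thesis
    by (simp add: out_degree_def card_image)
qed

lemma (in digraph) card_in_neighbours: "card {u. u \<rightarrow> v} = in_degree G v"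
proof -
  have "{u. u \<rightarrow> v} = tail G ` in_arcs G v"
    by (auto simp: arcs_ends_def arc_to_ends_def)
  moreover have "inj_on (tail G) (in_arcs G v)"
    using no_multi_arcs by (auto simp: inj_on_def arc_to_ends_def)
  ultimately show ?thesis
    by (simp add: in_degree_def card_image)
qed

text \<open>The arcs are partitioned by their tails.\<close>

lemma (in fin_digraph) sum_out_degree: "(\<Sum>v\<in>verts G. out_degree G v) = card (arcs G)"
  unfolding out_degree_def out_arcs_def
  using sum.group[of "arcs G" "verts G" "tail G" "\<lambda>_. 1::nat"]
  by (simp add: image_subset_iff)

lemma (in fin_digraph) sum_in_degree: "(\<Sum>v\<in>verts G. in_degree G v) = card (arcs G)"
  unfolding in_degree_def in_arcs_def
  using sum.group[of "arcs G" "verts G" "head G" "\<lambda>_. 1::nat"]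
  by (simp add: image_subset_iff)

section \<open>Degree counting and conclusion\<close>

lemma in_degree_sequence_eq:
  assumes "in_degree_sequence G = ds"
  shows "image_mset (in_degree G) (mset_set (verts G)) = mset ds"
  using assms unfolding in_degree_sequence_def by (metis mset_sorted_list_of_multiset)

theorem theorem5:
  shows "\<nexists>G :: ('a, 'b) pre_digraph.
    digraph G \<and> k_geodetic 2 G \<and> card (verts G) = 9 \<and> min_out_degree G \<ge> 2 \<and>
    in_degree_sequence G = [1] @ replicate 7 2 @ [3]"
proof (rule notI, elim exE conjE)
  fix G :: "('a, 'b) pre_digraph"
  assume "digraph G" and geod: "k_geodetic 2 G" and card_V: "card (verts G) = 9"
    and out: "min_out_degree G \<ge> 2"
    and seq: "in_degree_sequence G = [1] @ replicate 7 2 @ [3]"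
  interpret digraph G by fact
  let ?V = "verts G"
  have "mset ([1] @ replicate 7 2 @ [3]) = {#1, 3#} + replicate_mset 7 (2::nat)"
    by simp
  with in_degree_sequence_eq[OF seq]
  have ds: "image_mset (in_degree G) (mset_set ?V) = add_mset 1 (add_mset 3 (replicate_mset 7 2))"
    by simp
  \<comment> \<open>Preimages of the entries 1 and 3 are split off the multiset of vertices one at a
    time, leaving seven vertices of in-degree 2.\<close>
  obtain z B where z: "mset_set ?V = add_mset z B" "in_degree G z = 1"
    and B: "image_mset (in_degree G) B = add_mset 3 (replicate_mset 7 2)"
    using msed_map_invR[OF ds] by blast
  obtain x C where x: "B = add_mset x C" "in_degree G x = 3"
    and C: "image_mset (in_degree G) C = replicate_mset 7 2"
    using msed_map_invR[OF B] by blast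
  have V: "?V = insert z (insert x (set_mset C))"
    using z x finite_set_mset_mset_set[OF finite_verts] by auto
  have "in_degree G ` set_mset C = {2}"
    using arg_cong[OF C, of set_mset] by simp
  then have in_2: "in_degree G v = 2" if "v \<in> ?V - {x, z}" for v
    using that V by auto
  \<comment> \<open>The sum 1 + 3 + 7 * 2 is twice the order, so the lower bound 2 on the
    out-degrees is attained at every vertex.\<close>
  have "(\<Sum>v\<in>?V. in_degree G v) = 18"
    using arg_cong[OF ds, of sum_mset] by (simp add: sum_unfold_sum_mset)
  then have sum_out: "(\<Sum>v\<in>?V. out_degree G v) = (\<Sum>v\<in>?V. 2)"
    using sum_out_degree sum_in_degree card_V by simp
  have out_ge: "out_degree G v \<ge> 2" if "v \<in> ?V" for v
    using order_trans[OF out[unfolded min_out_degree_def] Min_le] that by simp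
  have out_2: "out_degree G v = 2" if "v \<in> ?V" for v
    using sum_mono_inv[of "\<lambda>_. 2" ?V "out_degree G" v] sum_out out_ge that by simp
  have "x \<in> ?V" "z \<in> ?V"
    using V x(1) by auto
  then show False
    using x(2) z(2) out_2 in_2 geodetic2.degree_2_except_1_3_False
      [OF geodetic2_dominates[OF geod] finite_verts card_V, of x z]
    unfolding card_out_neighbours card_in_neighbours by (meson adj_in_verts)
qed

end
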